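(* For every positive integer $m$, $$C(m)<8.25\,(\sqrt[3]{3})^m.$$
   Context: Graphs are finite and simple. For a graph $G$, $C(G)$ denotes the number of cycles in $G$ (as subgraphs). For $m\in\mathbb{Z}^+$, $C(m)$ denotes the maximum of $C(G)$ over all graphs $G$ with exactly $m$ edges (with any number of vertices). *)

theory Defs
  imports Complex_Main
begin

record 'a ugraph =
  verts :: "'a set"
  edges :: "'a set set"

definition simple_graph :: "'a ugraph \<Rightarrow> bool" where
  "simple_graph G \<longleftrightarrow> finite (verts G) \<and>
     edges G \<subseteq> {{u, v} | u v. u \<in> verts G \<and> v \<in> verts G \<and> u \<noteq> v}"

definition subgraph :: "'a ugraph \<Rightarrow> 'a ugraph \<Rightarrow> bool" where
  "subgraph H G \<longleftrightarrow> simple_graph H \<and> verts H \<subseteq> verts G \<and> edges H \<subseteq> edges G"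

definition cycle_graph :: "'a ugraph \<Rightarrow> bool" where
  "cycle_graph H \<longleftrightarrow> (\<exists>vs. distinct vs \<and> length vs \<ge> 3 \<and> verts H = set vs \<and>
     edges H = {{vs ! i, vs ! (Suc i mod length vs)} | i. i < length vs})"

definition num_cycles :: "'a ugraph \<Rightarrow> nat" where
  "num_cycles G = card {H. subgraph H G \<and> cycle_graph H}"

(* Taking vertices in nat loses no generality: the maximum exists (max_cycles_attained)
   and bounds the finite simple graphs over every vertex type (num_cycles_le_max_cycles). *)
definition max_cycles :: "nat \<Rightarrow> nat" where
  "max_cycles m = Max {num_cycles G | G :: nat ugraph. simple_graph G \<and> card (edges G) = m}"

lemma simple_graph_finite_edges:
  assumes "simple_graph G"
  shows "finite (edges G)"
proof -
  have "edges G \<subseteq> Pow (verts G)" "finite (verts G)"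
    using assms by (auto simp: simple_graph_def)
  then show ?thesis by (meson finite_Pow_iff finite_subset)
qed

lemma cycle_graph_verts:
  assumes "cycle_graph H"
  shows "verts H = \<Union> (edges H)"
proof -
  obtain vs where vs: "length vs \<ge> 3" "verts H = set vs"
      "edges H = {{vs ! i, vs ! (Suc i mod length vs)} | i. i < length vs}"
    using assms by (auto simp: cycle_graph_def)
  have "Suc i mod length vs < length vs" for i
    using vs(1) by (intro mod_less_divisor) auto
  then have "\<Union> (edges H) \<subseteq> set vs" unfolding vs(3) by auto
  moreover have "set vs \<subseteq> \<Union> (edges H)"
  proof
    fix x assume "x \<in> set vs"
    then obtain i where "i < length vs" "x = vs ! i" by (auto simp: in_set_conv_nth)
    then show "x \<in> \<Union> (edges H)" unfolding vs(3) by blast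
  qed
  ultimately show ?thesis using vs(2) by blast
qed

lemma inj_on_edges_cycles: "inj_on edges {H :: 'a ugraph. cycle_graph H}"
proof (rule inj_onI)
  fix H K :: "'a ugraph"
  assume "H \<in> {H. cycle_graph H}" "K \<in> {H. cycle_graph H}" "edges H = edges K"
  then have "verts H = verts K" by (simp add: cycle_graph_verts)
  then show "H = K" using \<open>edges H = edges K\<close> by simp
qed

lemma finite_cycles:
  assumes "simple_graph G"
  shows "finite {H. subgraph H G \<and> cycle_graph H}" (is "finite ?C")
proof (rule inj_on_finite)
  show "inj_on edges ?C" by (rule inj_on_subset[OF inj_on_edges_cycles]) auto
  show "edges ` ?C \<subseteq> Pow (edges G)" by (auto simp: subgraph_def)
  show "finite (Pow (edges G))" using simple_graph_finite_edges[OF assms] by simp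
qed

lemma num_cycles_le_power:
  assumes "simple_graph G"
  shows "num_cycles G \<le> 2 ^ card (edges G)"
proof -
  let ?C = "{H. subgraph H G \<and> cycle_graph H}"
  have fin: "finite (edges G)" by (rule simple_graph_finite_edges[OF assms])
  have "card ?C \<le> card (Pow (edges G))"
  proof (rule card_inj_on_le)
    show "inj_on edges ?C" by (rule inj_on_subset[OF inj_on_edges_cycles]) auto
    show "edges ` ?C \<subseteq> Pow (edges G)" by (auto simp: subgraph_def)
    show "finite (Pow (edges G))" using fin by simp
  qed
  then show ?thesis using fin by (simp add: num_cycles_def card_Pow)
qed

lemma finite_num_cycles:
  "finite {num_cycles G | G :: nat ugraph. simple_graph G \<and> card (edges G) = m}"
  by (rule finite_subset[of _ "{..2 ^ m}"]) (auto dest: num_cycles_le_power)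

lemma exists_graph_with_edges:
  "\<exists>G :: nat ugraph. simple_graph G \<and> card (edges G) = m"
proof -
  define G :: "nat ugraph" where "G = \<lparr>verts = {..m}, edges = (\<lambda>i. {i, Suc i}) ` {..<m}\<rparr>"
  have "inj_on (\<lambda>i. {i, Suc i}) {..<m}" by (auto simp: inj_on_def doubleton_eq_iff)
  then have "card (edges G) = m" by (simp add: G_def card_image)
  moreover have "simple_graph G"
    unfolding simple_graph_def G_def
    by (simp, rule image_subsetI)
       (metis (mono_tags, lifting) lessThan_iff less_imp_le_nat Suc_leI mem_Collect_eq n_not_Suc_n)
  ultimately show ?thesis by blast
qed

lemma max_cycles_attained:
  "\<exists>G :: nat ugraph. simple_graph G \<and> card (edges G) = m \<and> num_cycles G = max_cycles m"
proof -
  have "max_cycles m \<in> {num_cycles G | G :: nat ugraph. simple_graph G \<and> card (edges G) = m}"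
    unfolding max_cycles_def using exists_graph_with_edges[of m]
    by (intro Max_in finite_num_cycles) auto
  then show ?thesis by auto
qed

definition map_ugraph :: "('a \<Rightarrow> 'b) \<Rightarrow> 'a ugraph \<Rightarrow> 'b ugraph" where
  "map_ugraph f G = \<lparr>verts = f ` verts G, edges = (\<lambda>e. f ` e) ` edges G\<rparr>"

lemma simple_graph_map_ugraph:
  assumes "simple_graph G" "inj_on f (verts G)"
  shows "simple_graph (map_ugraph f G)"
  unfolding simple_graph_def
proof
  show "finite (verts (map_ugraph f G))"
    using assms by (simp add: simple_graph_def map_ugraph_def)
  show "edges (map_ugraph f G) \<subseteq> {{u, v} | u v. u \<in> verts (map_ugraph f G) \<and>
      v \<in> verts (map_ugraph f G) \<and> u \<noteq> v}"
  proof
    fix e assume "e \<in> edges (map_ugraph f G)"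
    then obtain d where d: "d \<in> edges G" "e = f ` d" by (auto simp: map_ugraph_def)
    then obtain u v where "d = {u, v}" "u \<in> verts G" "v \<in> verts G" "u \<noteq> v"
      using assms(1) by (auto simp: simple_graph_def)
    then have "e = {f u, f v}" "f u \<in> f ` verts G" "f v \<in> f ` verts G" "f u \<noteq> f v"
      using d assms(2) by (auto dest: inj_onD)
    then show "e \<in> {{u, v} | u v. u \<in> verts (map_ugraph f G) \<and>
      v \<in> verts (map_ugraph f G) \<and> u \<noteq> v}"
      unfolding map_ugraph_def by auto
  qed
qed

lemma cycle_graph_map_ugraph:
  assumes "cycle_graph H" "inj_on f (verts H)"
  shows "cycle_graph (map_ugraph f H)"
proof -
  obtain vs where vs: "distinct vs" "length vs \<ge> 3" "verts H = set vs"
      "edges H = {{vs ! i, vs ! (Suc i mod length vs)} | i. i < length vs}"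
    using assms by (auto simp: cycle_graph_def)
  have m: "Suc i mod length vs < length vs" for i
    using vs(2) by (intro mod_less_divisor) auto
  have "edges (map_ugraph f H) =
      (\<lambda>i. f ` {vs ! i, vs ! (Suc i mod length vs)}) ` {..<length vs}"
    unfolding map_ugraph_def ugraph.simps vs(4) by blast
  also have "\<dots> = (\<lambda>i. {map f vs ! i, map f vs ! (Suc i mod length vs)}) ` {..<length vs}"
    using m by (intro image_cong) auto
  finally have "edges (map_ugraph f H) =
      {{map f vs ! i, map f vs ! (Suc i mod length (map f vs))} | i. i < length (map f vs)}"
    unfolding length_map by blast
  moreover have "distinct (map f vs)" using vs assms(2) by (simp add: distinct_map)
  ultimately show ?thesis unfolding cycle_graph_def
    using vs by (intro exI[of _ "map f vs"]) (simp_all add: map_ugraph_def)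
qed

lemma num_cycles_le_max_cycles:
  fixes G :: "'a ugraph"
  assumes G: "simple_graph G"
  shows "num_cycles G \<le> max_cycles (card (edges G))"
proof -
  have "finite (verts G)" using G by (simp add: simple_graph_def)
  then obtain f :: "'a \<Rightarrow> nat" where f: "inj_on f (verts G)"
    using finite_imp_inj_to_nat_seg by blast
  let ?G = "map_ugraph f G"
  have sG: "simple_graph ?G" by (rule simple_graph_map_ugraph[OF G f])
  have sub: "edges G \<subseteq> Pow (verts G)" using G by (auto simp: simple_graph_def)
  have inj_im: "inj_on (\<lambda>e. f ` e) (Pow (verts G))"
    using f by (rule inj_on_image_Pow)
  have card: "card (edges ?G) = card (edges G)"
    using inj_on_subset[OF inj_im sub] by (simp add: map_ugraph_def card_image)
  have "num_cycles G \<le> num_cycles ?G"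
    unfolding num_cycles_def
  proof (rule card_inj_on_le)
    show "inj_on (map_ugraph f) {H. subgraph H G \<and> cycle_graph H}"
    proof (rule inj_onI)
      fix H K
      assume H: "H \<in> {H. subgraph H G \<and> cycle_graph H}"
        and K: "K \<in> {H. subgraph H G \<and> cycle_graph H}"
        and eq: "map_ugraph f H = map_ugraph f K"
      have "edges H \<subseteq> Pow (verts G)" "edges K \<subseteq> Pow (verts G)"
        using H K sub by (auto simp: subgraph_def)
      moreover have "(\<lambda>e. f ` e) ` edges H = (\<lambda>e. f ` e) ` edges K"
        using eq by (simp add: map_ugraph_def)
      ultimately have "edges H = edges K"
        by (simp only: inj_on_image_eq_iff[OF inj_im])
      then show "H = K" using H K by (intro inj_onD[OF inj_on_edges_cycles]) simp_all
    qed
    show "map_ugraph f ` {H. subgraph H G \<and> cycle_graph H}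
        \<subseteq> {H. subgraph H ?G \<and> cycle_graph H}"
    proof (rule image_subsetI, rule CollectI, rule conjI)
      fix H assume H: "H \<in> {H. subgraph H G \<and> cycle_graph H}"
      then have inj: "inj_on f (verts H)"
        using f by (auto simp: subgraph_def intro: inj_on_subset)
      then show "cycle_graph (map_ugraph f H)"
        using H by (auto intro: cycle_graph_map_ugraph)
      have "simple_graph (map_ugraph f H)"
        using H inj by (auto simp: subgraph_def intro: simple_graph_map_ugraph)
      then show "subgraph (map_ugraph f H) ?G"
        using H by (auto simp: subgraph_def map_ugraph_def)
    qed
    show "finite {H. subgraph H ?G \<and> cycle_graph H}" by (rule finite_cycles[OF sG])
  qed
  also have "num_cycles ?G \<le> max_cycles (card (edges G))"
    unfolding max_cycles_def using sG card
    by (intro Max_ge finite_num_cycles) auto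
  finally show ?thesis .
qed

end

(* Fix the endpoints of a path. Deleting its first vertex, of degree d, leaves d choices for the
   next vertex and destroys d edges. Since d <= r ^ d for r = root 3 3, with equality at d = 3,
   induction bounds the number of paths by r ^ m. A cycle through an edge is that edge together
   with a path joining its ends in the rest of the graph, so removing the edges one after another
   bounds the number of cycles by a geometric series. *)

theory Submission
  imports Defs
begin

section \<open>Vertex lists as paths, and the bound for paths with fixed ends\<close>

section \<open>Paths\<close>

fun path_edges :: "'a list \<Rightarrow> 'a set set" where
  "path_edges (x # y # zs) = insert {x, y} (path_edges (y # zs))"
| "path_edges _ = {}"

lemma path_edges_Cons: "xs \<noteq> [] \<Longrightarrow> path_edges (x # xs) = insert {x, hd xs} (path_edges xs)"
  by (cases xs) auto

lemma path_edge_subset: "e \<in> path_edges p \<Longrightarrow> e \<subseteq> set p"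
  by (induction p rule: path_edges.induct) auto

lemma path_edges_append:
  "xs \<noteq> [] \<Longrightarrow> ys \<noteq> [] \<Longrightarrow>
    path_edges (xs @ ys) = insert {last xs, hd ys} (path_edges xs \<union> path_edges ys)"
  by (induction xs rule: path_edges.induct) (auto simp: path_edges_Cons)

text \<open>Used to cut the vertex list of a cycle at a prescribed edge, so that rotation turns this
  edge into the closing one.\<close>

lemma path_edges_split:
  assumes "e \<in> path_edges p"
  obtains xs ys where "p = xs @ ys" "xs \<noteq> []" "ys \<noteq> []" "e = {last xs, hd ys}"
proof -
  have "\<exists>xs ys. p = xs @ ys \<and> xs \<noteq> [] \<and> ys \<noteq> [] \<and> e = {last xs, hd ys}"
    using assms
  proof (induction p rule: path_edges.induct)
    case (1 x y zs)
    show ?case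
    proof (cases "e = {x, y}")
      case True
      then show ?thesis by (intro exI[of _ "[x]"] exI[of _ "y # zs"]) simp
    next
      case False
      then obtain xs ys where "y # zs = xs @ ys" "xs \<noteq> []" "ys \<noteq> []" "e = {last xs, hd ys}"
        using 1 by auto
      then show ?thesis by (intro exI[of _ "x # xs"] exI[of _ ys]) simp
    qed
  qed simp_all
  then show ?thesis using that by blast
qed

lemma path_edges_conv_nth:
  "path_edges p = (\<lambda>i. {p ! i, p ! Suc i}) ` {..<length p - 1}"
  by (induction p rule: path_edges.induct) (simp_all add: lessThan_Suc_eq_insert_0 image_image)

text \<open>Only an edge set is given, so deleting a vertex amounts to filtering \<open>E\<close>;
  the trivial path \<open>[u]\<close> exists for every \<open>u\<close>.\<close>

definition paths :: "'a set set \<Rightarrow> 'a \<Rightarrow> 'a \<Rightarrow> 'a list set" where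
  "paths E u v = {p. p \<noteq> [] \<and> distinct p \<and> hd p = u \<and> last p = v \<and> path_edges p \<subseteq> E}"

lemma paths_self: "paths E u u = {[u]}"
proof -
  have "p = [u]" if "p \<in> paths E u u" for p
    using that by (cases p) (auto simp: paths_def split: if_splits)
  then show ?thesis by (auto simp: paths_def)
qed

text \<open>By distinctness the rest of the path never returns to \<open>u\<close>, so it survives
  the removal of all edges at \<open>u\<close>.\<close>

lemma paths_step:
  assumes "u \<noteq> v"
  shows "paths E u v \<subseteq>
    (\<Union>w\<in>{w. w \<noteq> u \<and> {u, w} \<in> E}. (#) u ` paths {e \<in> E. u \<notin> e} w v)"
proof
  fix p assume p: "p \<in> paths E u v"
  then obtain q where q: "p = u # q" "q \<noteq> []"
    using assms by (cases p) (auto simp: paths_def split: if_splits)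
  have "hd q \<noteq> u" "{u, hd q} \<in> E" "q \<in> paths {e \<in> E. u \<notin> e} (hd q) v"
    using p q path_edge_subset[of _ q]
    by (auto simp: paths_def path_edges_Cons dest: list.set_sel)
  then show "p \<in> (\<Union>w\<in>{w. w \<noteq> u \<and> {u, w} \<in> E}. (#) u ` paths {e \<in> E. u \<notin> e} w v)"
    using q by blast
qed

lemma cube_le_3_power: "d ^ 3 \<le> (3::nat) ^ d"
proof (cases "d < 3")
  case True
  then consider "d = 0" | "d = 1" | "d = 2" by linarith
  then show ?thesis by cases auto
next
  case False
  then have "3 \<le> d" by simp
  then show ?thesis
  proof (induction d rule: dec_induct)
    case (step d)
    \<comment> \<open>For d >= 3 both 3 d^2 and 3 d + 1 <= 9 d are at most d^3, so (d + 1)^3 <= 3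
      d^3.\<close>
    have "3 * d ^ 2 \<le> d * d ^ 2" using step.hyps by (intro mult_right_mono) auto
    moreover have "9 * d \<le> d ^ 2 * d"
      using power_mono[of 3 d 2] step.hyps by (intro mult_right_mono) auto
    moreover have "d * d ^ 2 = d ^ 3" "d ^ 2 * d = d ^ 3"
      by (simp_all add: power2_eq_square power3_eq_cube)
    moreover have "Suc d ^ 3 = d ^ 3 + 3 * d ^ 2 + 3 * d + 1"
      by (simp add: power2_eq_square power3_eq_cube algebra_simps)
    ultimately have "Suc d ^ 3 \<le> 3 * d ^ 3" using step.hyps by linarith
    then show ?case using step.IH by simp
  qed simp
qed

lemma le_root3_power: "real d \<le> root 3 3 ^ d"
proof (rule power_le_imp_le_base)
  have "real d ^ Suc 2 = real (d ^ 3)" by simp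
  also have "\<dots> \<le> real (3 ^ d)" using cube_le_3_power by (simp only: of_nat_le_iff)
  also have "\<dots> = (root 3 3 ^ d) ^ 3"
    by (simp add: power_mult[symmetric] mult.commute[of d]) (simp add: power_mult)
  finally show "real d ^ Suc 2 \<le> (root 3 3 ^ d) ^ Suc 2" by simp
qed simp

lemma card_paths_le:
  assumes "finite E"
  shows "finite (paths E u v)" "real (card (paths E u v)) \<le> root 3 3 ^ card E"
proof -
  have "finite (paths E u v) \<and> real (card (paths E u v)) \<le> root 3 3 ^ card E"
    using assms
  proof (induction "card E" arbitrary: E u rule: less_induct)
    case less
    let ?r = "root 3 3 :: real"
    define N where "N = {w. w \<noteq> u \<and> {u, w} \<in> E}"
    define D where "D = {e \<in> E. u \<in> e}"
    define R where "R = {e \<in> E. u \<notin> e}"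
    have fin: "finite D" "finite R" using less.prems by (auto simp: D_def R_def)
    \<comment> \<open>Members of \<open>E\<close> are arbitrary sets, so \<open>D\<close> may
      contain more than the pairs {u, w}; hence an inequality only.\<close>
    have "inj_on (\<lambda>w. {u, w}) N" "(\<lambda>w. {u, w}) ` N \<subseteq> D"
      by (auto simp: inj_on_def N_def D_def doubleton_eq_iff)
    then have N: "finite N" "card N \<le> card D"
      using fin by (auto intro: inj_on_finite card_inj_on_le)
    have "E = D \<union> R" "D \<inter> R = {}" by (auto simp: D_def R_def)
    then have E: "card E = card D + card R"
      using fin by (simp add: card_Un_disjoint)
    consider "u = v" | "u \<noteq> v" "N = {}" | "u \<noteq> v" "N \<noteq> {}" by blast
    then show ?case
    proof cases
      case 1
      then show ?thesis by (simp add: paths_self)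
    next
      case 2
      then have "paths E u v = {}" using paths_step[of u v E] by (fastforce simp: N_def)
      then show ?thesis by simp
    next
      case 3
      then have "0 < card N" using N by (simp add: card_gt_0_iff)
      \<comment> \<open>A neighbour of \<open>u\<close> gives an edge at \<open>u\<close>, so
        \<open>R\<close> is strictly smaller and the induction hypothesis applies from every start
        \<open>w\<close>.\<close>
      then have "card R < card E" using N E by linarith
      then have IH: "finite (paths R w v)" "real (card (paths R w v)) \<le> ?r ^ card R" for w
        using less.hyps fin by blast+
      let ?P = "\<Union>w\<in>N. (#) u ` paths R w v"
      have sub: "paths E u v \<subseteq> ?P"
        using paths_step[OF 3(1), of E] by (simp add: N_def R_def)
      have finP: "finite ?P" using N IH by simp
      have "real (card (paths E u v)) \<le> real (card ?P)"
        using sub finP by (simp add: card_mono)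
      also have "\<dots> \<le> real (\<Sum>w\<in>N. card ((#) u ` paths R w v))"
        using card_UN_le[OF N(1)] by (simp only: of_nat_le_iff)
      also have "\<dots> = (\<Sum>w\<in>N. real (card (paths R w v)))"
        by (simp add: card_image)
      also have "\<dots> \<le> real (card N) * ?r ^ card R"
        using IH by (intro sum_bounded_above) auto
      also have "\<dots> \<le> real (card D) * ?r ^ card R"
        using N by (intro mult_right_mono) auto
      also have "\<dots> \<le> ?r ^ card D * ?r ^ card R"
        by (intro mult_right_mono le_root3_power) simp
      also have "\<dots> = ?r ^ card E" by (simp add: E power_add)
      finally show ?thesis using sub finP finite_subset by blast
    qed
  qed
  then show "finite (paths E u v)" "real (card (paths E u v)) \<le> root 3 3 ^ card E" by auto
qed

section \<open>Cutting cycles open at an edge, and adding edges one by one\<close>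

section \<open>Cycles\<close>

definition cycle_edges :: "'a list \<Rightarrow> 'a set set" where
  "cycle_edges vs = insert {last vs, hd vs} (path_edges vs)"

lemma cycle_edges_conv_nth:
  assumes "vs \<noteq> []"
  shows "{{vs ! i, vs ! (Suc i mod length vs)} | i. i < length vs} = cycle_edges vs"
proof -
  obtain n where n: "length vs = Suc n" using assms by (cases vs) auto
  have "{{vs ! i, vs ! (Suc i mod length vs)} | i. i < length vs} =
      (\<lambda>i. {vs ! i, vs ! (Suc i mod Suc n)}) ` insert n {..<n}"
    unfolding n by (auto simp: less_Suc_eq)
  also have "\<dots> = insert {vs ! n, vs ! 0} ((\<lambda>i. {vs ! i, vs ! Suc i}) ` {..<n})"
    by simp
  also have "\<dots> = cycle_edges vs"
    using n assms by (simp add: cycle_edges_def path_edges_conv_nth last_conv_nth hd_conv_nth)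
  finally show ?thesis .
qed

lemma cycle_edges_rotate:
  "xs \<noteq> [] \<Longrightarrow> ys \<noteq> [] \<Longrightarrow> cycle_edges (xs @ ys) = cycle_edges (ys @ xs)"
  by (auto simp: cycle_edges_def path_edges_append)

text \<open>Cycles are represented by their edge sets, which determine them by
  \<open>inj_on_edges_cycles\<close>. No ambient graph is involved, which allows induction on
  \<open>E\<close>.\<close>

definition cycle_sets :: "'a set set \<Rightarrow> 'a set set set" where
  "cycle_sets E = {F. F \<subseteq> E \<and> (\<exists>vs. distinct vs \<and> length vs \<ge> 3 \<and> F = cycle_edges vs)}"

text \<open>The first vertex lies on just one path edge, whose other end is the second vertex; with
  three or more vertices the last one differs from it.\<close>

lemma closing_edge_notin_path_edges:
  assumes "distinct vs" "length vs \<ge> 3"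
  shows "{last vs, hd vs} \<notin> path_edges vs"
proof -
  obtain x y z zs where vs: "vs = x # y # z # zs"
    using assms(2) by (auto simp: numeral_3_eq_3 Suc_le_length_iff)
  have "last (z # zs) \<in> set (z # zs)" by (rule last_in_set) simp
  then have "last vs \<noteq> y" "hd vs = x" "x \<noteq> y" using assms(1) vs by auto
  moreover have "x \<notin> \<Union> (path_edges (y # z # zs))"
    using assms(1) vs path_edge_subset[of _ "y # z # zs"] by fastforce
  ultimately show ?thesis unfolding vs by (auto simp: doubleton_eq_iff)
qed

lemma cycle_through_edge:
  assumes "F \<in> cycle_sets (insert e E)" "e \<in> F"
  obtains p where "p \<in> paths E (hd p) (last p)" "e = {last p, hd p}" "F = insert e (path_edges p)"
proof -
  obtain vs where vs: "distinct vs" "length vs \<ge> 3" "F = cycle_edges vs" "F \<subseteq> insert e E"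
    using assms(1) by (auto simp: cycle_sets_def)
  obtain p where p: "distinct p" "length p \<ge> 3" "F = cycle_edges p" "e = {last p, hd p}"
  proof (cases "e = {last vs, hd vs}")
    case True
    then show ?thesis using vs that by blast
  next
    case False
    then have "e \<in> path_edges vs" using assms(2) vs(3) by (simp add: cycle_edges_def)
    then obtain xs ys where s: "vs = xs @ ys" "xs \<noteq> []" "ys \<noteq> []" "e = {last xs, hd ys}"
      by (rule path_edges_split)
    \<comment> \<open>The rotated list starts at \<open>hd ys\<close> and ends at
      \<open>last xs\<close>, so \<open>e\<close> becomes its closing edge.\<close>
    show ?thesis
      by (rule that[of "ys @ xs"]) (use vs s in \<open>auto simp: cycle_edges_rotate\<close>)
  qed
  have "path_edges p \<subseteq> E"
    using closing_edge_notin_path_edges[OF p(1,2)] p(3,4) vs(4) by (auto simp: cycle_edges_def)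
  moreover have "p \<noteq> []" using p(2) by auto
  ultimately show ?thesis
    using p by (intro that[of p]) (auto simp: paths_def cycle_edges_def)
qed

lemma finite_cycle_sets: "finite E \<Longrightarrow> finite (cycle_sets E)"
  by (rule finite_subset[of _ "Pow E"]) (auto simp: cycle_sets_def)

text \<open>The new cycles are those through \<open>e\<close>. The path left after removing
  \<open>e\<close> may be read from either end, and counting both directions gives the factor
  2.\<close>

lemma card_cycle_sets_insert:
  assumes "finite E"
  shows "real (card (cycle_sets (insert e E))) \<le> real (card (cycle_sets E)) + 2 * root 3 3 ^ card E"
proof -
  let ?T = "{F \<in> cycle_sets (insert e E). e \<in> F}"
  have T: "real (card ?T) \<le> 2 * root 3 3 ^ card E"
  proof (cases "?T = {}")
    case True
    show ?thesis unfolding True by simp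
  next
    case False
    \<comment> \<open>Here \<open>e\<close> is an arbitrary set; a cycle through it shows that it is
      a pair.\<close>
    then obtain a b where e: "e = {a, b}" by (blast elim: cycle_through_edge)
    let ?P = "paths E a b \<union> paths E b a"
    have "?T \<subseteq> (\<lambda>p. insert e (path_edges p)) ` ?P"
    proof
      fix F assume "F \<in> ?T"
      then obtain p where p: "p \<in> paths E (hd p) (last p)" "e = {last p, hd p}"
          "F = insert e (path_edges p)"
        by (blast elim: cycle_through_edge)
      then have "p \<in> ?P" using e by (auto simp: doubleton_eq_iff)
      then show "F \<in> (\<lambda>p. insert e (path_edges p)) ` ?P" using p by blast
    qed
    moreover have "finite ?P" using card_paths_le(1)[OF assms] by blast
    ultimately have "card ?T \<le> card ?P" by (meson card_image_le card_mono finite_imageI le_trans)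
    also have "\<dots> \<le> card (paths E a b) + card (paths E b a)" by (rule card_Un_le)
    finally show ?thesis
      using card_paths_le(2)[OF assms, of a b] card_paths_le(2)[OF assms, of b a] by linarith
  qed
  have "cycle_sets (insert e E) \<subseteq> cycle_sets E \<union> ?T" by (auto simp: cycle_sets_def)
  moreover have "finite (cycle_sets E \<union> ?T)" using assms by (simp add: finite_cycle_sets)
  ultimately have "card (cycle_sets (insert e E)) \<le> card (cycle_sets E) + card ?T"
    by (meson card_Un_le card_mono le_trans)
  then show ?thesis using T by linarith
qed

lemma card_cycle_sets_le:
  assumes "finite E"
  shows "real (card (cycle_sets E)) \<le> 8 * root 3 3 ^ card E"
  using assms
proof (induction E rule: finite_induct)
  case empty
  have "cycle_sets {} = ({} :: 'a set set set)" by (auto simp: cycle_sets_def cycle_edges_def)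
  then show ?case by simp
next
  case (insert e E)
  \<comment> \<open>With r = \<open>root 3 3\<close>, a constant c passes the induction when c + 2
    <= c r. For c = 8 this is r >= 5/4, and (5/4)^3 = 125/64 < 3.\<close>
  have "(5 / 4 :: real) = root 3 ((5 / 4) ^ 3)" by (rule real_root_power_cancel[symmetric]) auto
  also have "\<dots> \<le> root 3 3" by (simp add: power3_eq_cube)
  finally have "10 * root 3 3 ^ card E \<le> 8 * root 3 3 * root 3 3 ^ card E"
    by (intro mult_right_mono) auto
  also have "\<dots> = 8 * root 3 3 ^ card (insert e E)" using insert.hyps by simp
  finally show ?case
    using insert.IH card_cycle_sets_insert[OF insert.hyps(1), of e] by linarith
qed

lemma num_cycles_le_card_cycle_sets:
  assumes "simple_graph G"
  shows "num_cycles G \<le> card (cycle_sets (edges G))"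
  unfolding num_cycles_def
proof (rule card_inj_on_le)
  show "inj_on edges {H. subgraph H G \<and> cycle_graph H}"
    by (rule inj_on_subset[OF inj_on_edges_cycles]) auto
  show "edges ` {H. subgraph H G \<and> cycle_graph H} \<subseteq> cycle_sets (edges G)"
  proof (rule image_subsetI)
    fix H assume H: "H \<in> {H. subgraph H G \<and> cycle_graph H}"
    then obtain vs where vs: "distinct vs" "length vs \<ge> 3"
        "edges H = {{vs ! i, vs ! (Suc i mod length vs)} | i. i < length vs}"
      by (auto simp: cycle_graph_def)
    then have "edges H = cycle_edges vs" by (subst vs(3), intro cycle_edges_conv_nth) auto
    then show "edges H \<in> cycle_sets (edges G)"
      using H vs(1,2) by (auto simp: cycle_sets_def subgraph_def)
  qed
  show "finite (cycle_sets (edges G))"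
    using assms by (simp add: finite_cycle_sets simple_graph_finite_edges)
qed

theorem corollary3p4:
  fixes m :: nat
  assumes "m > 0"
  shows "real (max_cycles m) < 8.25 * (root 3 3) ^ m"
proof -
  obtain G :: "nat ugraph" where G: "simple_graph G" "card (edges G) = m" "num_cycles G = max_cycles m"
    using max_cycles_attained by blast
  have "real (max_cycles m) \<le> real (card (cycle_sets (edges G)))"
    using num_cycles_le_card_cycle_sets[OF G(1)] G(3) by simp
  also have "\<dots> \<le> 8 * root 3 3 ^ m"
    using card_cycle_sets_le[OF simple_graph_finite_edges[OF G(1)]] G(2) by simp
  \<comment> \<open>Strictness comes from 8 < 8.25 and the positivity of the power.\<close>
  also have "\<dots> < 8.25 * root 3 3 ^ m" by simp
  finally show ?thesis .
qed

end
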